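(* Let $G$ be an equitably 3-colorable graph on $n\ge 2$ vertices and let $k\ge 2$, $l\ge 1$ be integers. If $3$ divides $n$ or $k=2$, then $\chi_{=}(G\circ^l C_{2k})=3$.
   Context: All graphs are finite, simple and connected. $C_m$ denotes the cycle on $m$ vertices. A graph is equitably $k$-colorable if its vertex set can be partitioned into $k$ (possibly empty) independent sets $V_1,\dots,V_k$ with $||V_i|-|V_j||\le 1$ for all $i,j$; $\chi_{=}(G)$ is the least $k$ for which $G$ is equitably $k$-colorable. The corona $G\circ H$ is formed from one copy of $G$ and $|V(G)|$ copies of $H$, the $i$-th vertex of $G$ being joined to every vertex of the $i$-th copy of $H$; $G\circ^1 H=G\circ H$ and $G\circ^l H=(G\circ^{l-1}H)\circ H$ for $l\ge 2$. *)

theory Defs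
  imports "Graph_Theory.Graph_Theory" "HOL-Library.Disjoint_Sets"
begin

text \<open>
  Finite simple graphs are the graphs of the locale \<^locale>\<open>pair_graph\<close>: finite, loop-free and
  symmetric, an edge between \<open>u\<close> and \<open>v\<close> being represented by the two arcs \<open>(u, v)\<close> and \<open>(v, u)\<close>.
\<close>

definition cycle_graph :: "nat \<Rightarrow> nat pair_pre_digraph" where
  "cycle_graph m = \<lparr> pverts = {..<m},
     parcs = {(i, j). i < m \<and> j < m \<and> (j = Suc i mod m \<or> i = Suc j mod m)} \<rparr>"

definition independent_set :: "'a pair_pre_digraph \<Rightarrow> 'a set \<Rightarrow> bool" where
  "independent_set G S \<longleftrightarrow> S \<subseteq> pverts G \<and> (\<forall>u\<in>S. \<forall>v\<in>S. (u, v) \<notin> parcs G)"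

definition equitably_colorable :: "'a pair_pre_digraph \<Rightarrow> nat \<Rightarrow> bool" where
  "equitably_colorable G k \<longleftrightarrow> (\<exists>V :: nat \<Rightarrow> 'a set.
     (\<Union>i<k. V i) = pverts G \<and> disjoint_family_on V {..<k} \<and>
     (\<forall>i<k. independent_set G (V i)) \<and>
     (\<forall>i<k. \<forall>j<k. \<bar>int (card (V i)) - int (card (V j))\<bar> \<le> 1))"

definition equitable_chromatic_number :: "'a pair_pre_digraph \<Rightarrow> nat" where
  "equitable_chromatic_number G = (LEAST k. equitably_colorable G k)"

text \<open>
  In the corona, \<open>Inl v\<close> is the vertex \<open>v\<close> of the copy of \<open>G\<close>, and \<open>Inr (v, x)\<close> is the vertex \<open>x\<close>
  of the copy of \<open>H\<close> attached to \<open>v\<close>.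
\<close>

definition corona ::
  "'a pair_pre_digraph \<Rightarrow> 'b pair_pre_digraph \<Rightarrow> ('a + 'a \<times> 'b) pair_pre_digraph" where
  "corona G H = \<lparr> pverts = Inl ` pverts G \<union> Inr ` (pverts G \<times> pverts H),
     parcs = {(Inl u, Inl v) | u v. (u, v) \<in> parcs G}
       \<union> {(Inr (v, x), Inr (v, y)) | v x y. v \<in> pverts G \<and> (x, y) \<in> parcs H}
       \<union> {(Inl v, Inr (v, x)) | v x. v \<in> pverts G \<and> x \<in> pverts H}
       \<union> {(Inr (v, x), Inl v) | v x. v \<in> pverts G \<and> x \<in> pverts H} \<rparr>"

text \<open>
  Each corona changes the type of the vertices. To iterate it, the vertices are renamed along the
  injective constructors of a type \<open>'c\<close> that contains both \<open>'a\<close> and \<open>'c + 'c \<times> 'b\<close>.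
\<close>

datatype ('a, 'b) corona_vertex =
    Base 'a
  | Step "('a, 'b) corona_vertex + ('a, 'b) corona_vertex \<times> 'b"

definition rename_verts :: "('a \<Rightarrow> 'b) \<Rightarrow> 'a pair_pre_digraph \<Rightarrow> 'b pair_pre_digraph" where
  "rename_verts f G = \<lparr> pverts = f ` pverts G, parcs = map_prod f f ` parcs G \<rparr>"

primrec iterated_corona ::
  "nat \<Rightarrow> 'a pair_pre_digraph \<Rightarrow> 'b pair_pre_digraph \<Rightarrow> ('a, 'b) corona_vertex pair_pre_digraph"
where
  "iterated_corona 0 G H = rename_verts Base G"
| "iterated_corona (Suc l) G H = rename_verts Step (corona (iterated_corona l G H) H)"

lemma digraph_iso_rename_verts:
  assumes "pair_wf_digraph G" "inj f"
  shows "digraph_iso (with_proj G) (with_proj (rename_verts f G))"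
proof -
  interpret pair_wf_digraph G by fact
  let ?h = "\<lparr> iso_verts = f, iso_arcs = map_prod f f, iso_head = snd, iso_tail = fst \<rparr>"
  have "pre_digraph.digraph_isomorphism (with_proj G) ?h"
    using assms(2) wf_digraph_axioms
    by (auto simp: pre_digraph.digraph_isomorphism_def inj_on_def map_prod_def
        split: prod.splits)
  moreover have "with_proj (rename_verts f G) = app_iso ?h (with_proj G)"
    by (simp add: app_iso_def with_proj_def rename_verts_def)
  ultimately show ?thesis unfolding digraph_iso_def by blast
qed

lemma pair_graph_rename_verts:
  assumes "pair_graph G" "inj f"
  shows "pair_graph (rename_verts f G)"
proof -
  interpret pair_graph G by fact
  have symG: "\<And>u v. (u, v) \<in> parcs G \<Longrightarrow> (v, u) \<in> parcs G"
    using sym_arcs by (auto simp: symmetric_def dest: symD)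
  moreover have "\<And>u v. (u, v) \<in> parcs G \<Longrightarrow> u \<noteq> v"
    using pair_no_loops by fastforce
  ultimately have noloop: "fst e \<noteq> snd e" if "e \<in> parcs (rename_verts f G)" for e
    using that \<open>inj f\<close> by (auto simp: rename_verts_def inj_eq)
  have wf: "parcs (rename_verts f G) \<subseteq> pverts (rename_verts f G) \<times> pverts (rename_verts f G)"
    by (auto simp: rename_verts_def dest: in_arcsD1 in_arcsD2)
  have "sym (parcs (rename_verts f G))"
    by (rule symI) (force simp: rename_verts_def dest: symG)
  moreover have "finite (pverts (rename_verts f G))" "finite (parcs (rename_verts f G))"
    by (simp_all add: rename_verts_def)
  ultimately show ?thesis
    using wf noloop by unfold_locales (auto simp: symmetric_def)
qed

lemma pair_graph_cycle_graph:
  assumes "m \<ge> 3"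
  shows "pair_graph (cycle_graph m)"
proof -
  have "finite {(i, j). i < m \<and> j < m \<and> (j = Suc i mod m \<or> i = Suc j mod m)}"
    by (rule finite_subset[of _ "{..<m} \<times> {..<m}"]) auto
  moreover have "Suc i mod m \<noteq> i" "i \<noteq> Suc i mod m" if "i < m" for i
    using that assms by (cases "Suc i = m"; auto)+
  ultimately show ?thesis
    by unfold_locales (auto simp: cycle_graph_def symmetric_def intro!: symI)
qed

lemma pair_graph_corona:
  assumes "pair_graph G" "pair_graph H"
  shows "pair_graph (corona G H)"
proof -
  interpret G: pair_graph G by fact
  interpret H: pair_graph H by fact
  have symG: "\<And>u v. (u, v) \<in> parcs G \<Longrightarrow> (v, u) \<in> parcs G"
    using G.sym_arcs by (auto simp: symmetric_def dest: symD)
  have symH: "\<And>u v. (u, v) \<in> parcs H \<Longrightarrow> (v, u) \<in> parcs H"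
    using H.sym_arcs by (auto simp: symmetric_def dest: symD)
  have wf: "parcs (corona G H) \<subseteq> pverts (corona G H) \<times> pverts (corona G H)"
    by (auto simp: corona_def dest: G.in_arcsD1 G.in_arcsD2 H.in_arcsD1 H.in_arcsD2)
  have fin: "finite (pverts (corona G H))"
    by (auto simp: corona_def)
  have "finite (parcs (corona G H))"
    using finite_subset[OF wf] fin by blast
  moreover have "sym (parcs (corona G H))"
    by (rule symI) (auto simp: corona_def symG symH)
  moreover have "fst e \<noteq> snd e" if "e \<in> parcs (corona G H)" for e
    using that by (auto simp: corona_def dest: G.pair_no_loops H.pair_no_loops)
  ultimately show ?thesis
    using wf fin by unfold_locales (auto simp: symmetric_def)
qed

lemma pair_graph_iterated_corona:
  assumes "pair_graph G" "pair_graph H"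
  shows "pair_graph (iterated_corona l G H)"
  using assms by (induction l) (auto intro!: pair_graph_rename_verts pair_graph_corona injI)

lemma digraph_iso_iterated_corona_Suc:
  assumes "pair_graph G" "pair_graph H"
  shows "digraph_iso (with_proj (corona (iterated_corona l G H) H))
    (with_proj (iterated_corona (Suc l) G H))"
proof -
  interpret pair_graph "corona (iterated_corona l G H) H"
    by (intro pair_graph_corona pair_graph_iterated_corona assms)
  show ?thesis
    by (auto intro!: digraph_iso_rename_verts injI)
qed

lemma arc_corona_simps [simp]:
  "(Inl u, Inl v) \<in> parcs (corona G H) \<longleftrightarrow> (u, v) \<in> parcs G"
  "(Inl u, Inr (v, y)) \<in> parcs (corona G H) \<longleftrightarrow> u = v \<and> v \<in> pverts G \<and> y \<in> pverts H"
  "(Inr (u, x), Inl v) \<in> parcs (corona G H) \<longleftrightarrow> u = v \<and> v \<in> pverts G \<and> x \<in> pverts H"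
  "(Inr (u, x), Inr (v, y)) \<in> parcs (corona G H) \<longleftrightarrow>
     u = v \<and> v \<in> pverts G \<and> (x, y) \<in> parcs H"
  by (auto simp: corona_def)

lemma corona_rename_verts:
  fixes f :: "'a \<Rightarrow> 'c" and G :: "'a pair_pre_digraph" and H :: "'b pair_pre_digraph"
  shows "corona (rename_verts f G) H = rename_verts (map_sum f (map_prod f id)) (corona G H)"
proof -
  let ?g = "map_sum f (map_prod f id) :: 'a + 'a \<times> 'b \<Rightarrow> 'c + 'c \<times> 'b"
  have "pverts (corona (rename_verts f G) H) = ?g ` pverts (corona G H)"
    by (force simp: corona_def rename_verts_def)
  moreover have "parcs (corona (rename_verts f G) H) = map_prod ?g ?g ` parcs (corona G H)"
    (is "?L = ?R")
  proof (intro equalityI subrelI)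
    fix p q assume pq: "(p, q) \<in> ?L"
    have "\<exists>p' q'. (p', q') \<in> parcs (corona G H) \<and> p = ?g p' \<and> q = ?g q'"
    proof (cases p; cases q)
      fix u v assume [simp]: "p = Inl u" "q = Inl v"
      from pq obtain u' v' where "(u', v') \<in> parcs G" "u = f u'" "v = f v'"
        by (auto simp: rename_verts_def)
      then show ?thesis by (intro exI[of _ "Inl u'"] exI[of _ "Inl v'"]) simp
    next
      fix u b assume [simp]: "p = Inl u" "q = Inr b"
      obtain v y where [simp]: "b = (v, y)" by fastforce
      from pq obtain v' where "v' \<in> pverts G" "v = f v'" "u = v" "y \<in> pverts H"
        by (auto simp: rename_verts_def)
      then show ?thesis by (intro exI[of _ "Inl v'"] exI[of _ "Inr (v', y)"]) simp
    next
      fix a v assume [simp]: "p = Inr a" "q = Inl v"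
      obtain u x where [simp]: "a = (u, x)" by fastforce
      from pq obtain v' where "v' \<in> pverts G" "v = f v'" "u = v" "x \<in> pverts H"
        by (auto simp: rename_verts_def)
      then show ?thesis by (intro exI[of _ "Inr (v', x)"] exI[of _ "Inl v'"]) simp
    next
      fix a b assume [simp]: "p = Inr a" "q = Inr b"
      obtain u x v y where [simp]: "a = (u, x)" "b = (v, y)" by fastforce
      from pq obtain v' where "v' \<in> pverts G" "v = f v'" "u = v" "(x, y) \<in> parcs H"
        by (auto simp: rename_verts_def)
      then show ?thesis by (intro exI[of _ "Inr (v', x)"] exI[of _ "Inr (v', y)"]) simp
    qed
    then show "(p, q) \<in> ?R" by (metis map_prod_imageI)
  next
    fix p q assume "(p, q) \<in> ?R"
    then obtain p' q' where pq: "(p', q') \<in> parcs (corona G H)" "p = ?g p'" "q = ?g q'"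
      by auto
    then show "(p, q) \<in> ?L"
      by (cases p'; cases q')
        (auto simp: rename_verts_def intro!: image_eqI[where f = "map_prod f f"])
  qed
  ultimately show ?thesis
    by (simp add: rename_verts_def)
qed

lemma iterated_corona_1:
  "iterated_corona 1 G H =
     rename_verts (Step \<circ> map_sum Base (map_prod Base id)) (corona G H)"
  by (simp add: corona_rename_verts)
    (simp add: rename_verts_def image_comp map_prod_compose)

end

theory Submission
  imports Defs
begin

text \<open>
  Given an equitable coloring of \<open>G\<close> with \<open>q + 1\<close> colors and a proper coloring of \<open>H\<close> whose \<open>q\<close>
  classes all have size \<open>k\<close>, color the copy of \<open>H\<close> attached to a vertex by the \<open>q\<close> colors which that
  vertex does not have. A color class of size \<open>a\<close> becomes one of size \<open>a + k (n - a)\<close>, so the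
  differences between class sizes are multiplied by \<open>-(k - 1)\<close>: they stay at most 1 if \<open>k \<le> 2\<close>, and
  they are 0 throughout if \<open>q + 1\<close> divides \<open>n\<close>. Fewer colors do not suffice if \<open>H\<close> contains a clique
  of size \<open>q\<close>, since that clique and the vertex it is attached to form a larger one. An even cycle
  satisfies all of this for \<open>q = 2\<close>.
\<close>

section \<open>Equitable colorings\<close>

definition color_class :: "'a pair_pre_digraph \<Rightarrow> ('a \<Rightarrow> nat) \<Rightarrow> nat \<Rightarrow> 'a set" where
  "color_class G c i = {v \<in> pverts G. c v = i}"

definition proper_coloring :: "'a pair_pre_digraph \<Rightarrow> nat \<Rightarrow> ('a \<Rightarrow> nat) \<Rightarrow> bool" where
  "proper_coloring G q c \<longleftrightarrow> (\<forall>v\<in>pverts G. c v < q) \<and>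
     (\<forall>u\<in>pverts G. \<forall>v\<in>pverts G. (u, v) \<in> parcs G \<longrightarrow> c u \<noteq> c v)"

definition equitable_coloring :: "'a pair_pre_digraph \<Rightarrow> nat \<Rightarrow> ('a \<Rightarrow> nat) \<Rightarrow> bool" where
  "equitable_coloring G q c \<longleftrightarrow> proper_coloring G q c \<and>
     (\<forall>i<q. \<forall>j<q. \<bar>int (card (color_class G c i)) - int (card (color_class G c j))\<bar> \<le> 1)"

lemma equitably_colorable_iff_equitable_coloring:
  "equitably_colorable G q \<longleftrightarrow> (\<exists>c. equitable_coloring G q c)"
proof
  assume "equitably_colorable G q"
  then obtain V :: "nat \<Rightarrow> 'a set"
    where cover: "(\<Union>i<q. V i) = pverts G" and disjoint: "disjoint_family_on V {..<q}"
      and independent: "\<forall>i<q. independent_set G (V i)"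
      and balanced: "\<forall>i<q. \<forall>j<q. \<bar>int (card (V i)) - int (card (V j))\<bar> \<le> 1"
    unfolding equitably_colorable_def by blast
  have "\<forall>v\<in>pverts G. \<exists>i<q. v \<in> V i" using cover by blast
  then obtain c where c: "\<And>v. v \<in> pverts G \<Longrightarrow> c v < q \<and> v \<in> V (c v)" by metis
  have "color_class G c i = V i" if "i < q" for i
    using c cover disjoint that unfolding color_class_def disjoint_family_on_def by blast
  moreover have "proper_coloring G q c"
    using c independent unfolding proper_coloring_def independent_set_def by metis
  ultimately show "\<exists>c. equitable_coloring G q c"
    using balanced by (auto simp: equitable_coloring_def)
next
  assume "\<exists>c. equitable_coloring G q c"
  then obtain c where c: "equitable_coloring G q c" ..
  then have "(\<Union>i<q. color_class G c i) = pverts G"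
    by (auto simp: equitable_coloring_def proper_coloring_def color_class_def)
  moreover have "disjoint_family_on (color_class G c) {..<q}"
    by (auto simp: disjoint_family_on_def color_class_def)
  moreover have "independent_set G (color_class G c i)" for i
    using c unfolding equitable_coloring_def proper_coloring_def color_class_def
      independent_set_def by blast
  ultimately show "equitably_colorable G q"
    using c unfolding equitably_colorable_def equitable_coloring_def by blast
qed

lemma sum_card_color_class:
  assumes "finite (pverts G)" and "proper_coloring G q c"
  shows "(\<Sum>i<q. card (color_class G c i)) = card (pverts G)"
  using assms sum.group[of "pverts G" "{..<q}" c "\<lambda>_. 1 :: nat"]
  by (auto simp: proper_coloring_def color_class_def)

lemma eq_average_if_balanced:
  fixes a :: "nat \<Rightarrow> nat"
  assumes balanced: "\<And>i j. i < q \<Longrightarrow> j < q \<Longrightarrow> \<bar>int (a i) - int (a j)\<bar> \<le> 1"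
    and sum: "(\<Sum>i<q. a i) = q * m" and "i < q"
  shows "a i = m"
proof (rule linorder_cases[of "a i" m])
  assume "a i < m"
  then have "\<forall>j<q. a j \<le> m" using balanced[OF \<open>i < q\<close>] by fastforce
  then have "(\<Sum>j<q. a j) < (\<Sum>j<q. m)"
    using \<open>a i < m\<close> \<open>i < q\<close> by (intro sum_strict_mono_ex1) auto
  then show ?thesis using sum by simp
next
  assume "m < a i"
  then have "\<forall>j<q. m \<le> a j" using balanced[OF \<open>i < q\<close>] by fastforce
  then have "(\<Sum>j<q. m) < (\<Sum>j<q. a j)"
    using \<open>m < a i\<close> \<open>i < q\<close> by (intro sum_strict_mono_ex1) auto
  then show ?thesis using sum by simp
qed

lemma card_color_class_eq_if_dvd:
  assumes "finite (pverts G)" and "equitable_coloring G q c" and "q dvd card (pverts G)"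
    and "i < q" and "j < q"
  shows "card (color_class G c i) = card (color_class G c j)"
proof -
  obtain m where "card (pverts G) = q * m" using assms(3) by (rule dvdE)
  then have "(\<Sum>i<q. card (color_class G c i)) = q * m"
    using assms(1,2) by (simp add: sum_card_color_class equitable_coloring_def)
  moreover have "\<bar>int (card (color_class G c i)) - int (card (color_class G c j))\<bar> \<le> 1"
    if "i < q" "j < q" for i j
    using assms(2) that by (simp add: equitable_coloring_def)
  ultimately have "card (color_class G c i) = m" if "i < q" for i
    using that by (intro eq_average_if_balanced[where a = "\<lambda>i. card (color_class G c i)"])
  with assms(4,5) show ?thesis by simp
qed

lemma card_color_class_recolor:
  assumes g: "bij_betw g {..<q} A" and less: "\<forall>v\<in>pverts G. c v < q"
    and k: "\<And>i. i < q \<Longrightarrow> card (color_class G c i) = k"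
  shows "card (color_class G (\<lambda>v. g (c v)) j) = (if j \<in> A then k else 0)"
proof (cases "j \<in> A")
  case True
  then have "j \<in> g ` {..<q}"
    using bij_betw_imp_surj_on[OF g] by simp
  then obtain i where i: "i < q" "g i = j" by blast
  have "g (c v) = j \<longleftrightarrow> c v = i" if "v \<in> pverts G" for v
    using bij_betw_imp_inj_on[OF g] less i that by (auto simp: inj_on_eq_iff)
  then have "color_class G (\<lambda>v. g (c v)) j = color_class G c i"
    by (auto simp: color_class_def)
  with True i k show ?thesis by simp
next
  case False
  then have "color_class G (\<lambda>v. g (c v)) j = {}"
    using bij_betwE[OF g] less by (auto simp: color_class_def)
  with False show ?thesis by simp
qed

section \<open>Renaming and coronas\<close>

lemma pverts_rename_verts [simp]: "pverts (rename_verts f G) = f ` pverts G"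
  by (simp add: rename_verts_def)

lemma arc_rename_verts_iff [simp]:
  "inj f \<Longrightarrow> (f u, f v) \<in> parcs (rename_verts f G) \<longleftrightarrow> (u, v) \<in> parcs G"
  by (auto simp: rename_verts_def inj_eq)

lemma pverts_corona [simp]: "pverts (corona G H) = pverts G <+> pverts G \<times> pverts H"
  by (simp add: corona_def Plus_def)

lemma equitable_coloring_rename_verts_iff:
  assumes "inj f"
  shows "equitable_coloring (rename_verts f G) q c \<longleftrightarrow> equitable_coloring G q (c \<circ> f)"
proof -
  have "color_class (rename_verts f G) c i = f ` color_class G (c \<circ> f) i" for i
    by (auto simp: color_class_def)
  then have "card (color_class (rename_verts f G) c i) = card (color_class G (c \<circ> f) i)" for i
    using assms by (simp add: card_image inj_on_subset)
  then show ?thesis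
    using assms by (simp add: equitable_coloring_def proper_coloring_def)
qed

lemma equitably_colorable_rename_verts_iff:
  assumes "inj f"
  shows "equitably_colorable (rename_verts f G) q \<longleftrightarrow> equitably_colorable G q"
proof -
  have "\<exists>c'. c = c' \<circ> f" for c :: "'a \<Rightarrow> nat"
    using assms by (metis comp_id inv_o_cancel o_assoc)
  then show ?thesis
    using assms unfolding equitably_colorable_iff_equitable_coloring
    by (metis equitable_coloring_rename_verts_iff)
qed

lemma finite_pverts_iterated_corona:
  assumes "finite (pverts G)" and "finite (pverts H)"
  shows "finite (pverts (iterated_corona l G H))"
  using assms by (induction l) auto

lemma card_pverts_iterated_corona:
  assumes "finite (pverts G)" and "finite (pverts H)"
  shows "card (pverts (iterated_corona l G H)) = card (pverts G) * Suc (card (pverts H)) ^ l"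
proof (induction l)
  case 0
  show ?case by (simp add: card_image inj_on_def)
next
  case (Suc l)
  have "card (pverts (iterated_corona (Suc l) G H))
      = card (pverts (corona (iterated_corona l G H) H))"
    by (simp add: card_image inj_on_def)
  also have "\<dots> = card (pverts (iterated_corona l G H)) * Suc (card (pverts H))"
    using assms by (simp add: card_Plus card_cartesian_product finite_pverts_iterated_corona)
  finally show ?case using Suc by (simp only: power_Suc2 mult.assoc)
qed

section \<open>Coloring a corona\<close>

text \<open>\<open>f j\<close> is meant to enumerate the colors other than \<open>j\<close>.\<close>

definition corona_coloring ::
  "(nat \<Rightarrow> nat \<Rightarrow> nat) \<Rightarrow> ('a \<Rightarrow> nat) \<Rightarrow> ('b \<Rightarrow> nat) \<Rightarrow> 'a + 'a \<times> 'b \<Rightarrow> nat" where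
  "corona_coloring f c d = case_sum c (\<lambda>(v, x). f (c v) (d x))"

lemma proper_coloring_corona_coloring:
  assumes f: "\<And>j. j < Suc q \<Longrightarrow> bij_betw (f j) {..<q} ({..<Suc q} - {j})"
    and c: "proper_coloring G (Suc q) c" and d: "proper_coloring H q d"
  shows "proper_coloring (corona G H) (Suc q) (corona_coloring f c d)"
proof -
  have less: "f j i < Suc q" and neq: "f j i \<noteq> j" if "j < Suc q" "i < q" for j i
    using bij_betwE[OF f[OF that(1)]] that(2) by auto
  have inj: "f j i = f j i' \<longleftrightarrow> i = i'" if "j < Suc q" "i < q" "i' < q" for j i i'
    using bij_betw_imp_inj_on[OF f[OF that(1)]] that(2,3) by (simp add: inj_on_eq_iff)
  have c_less: "c v < Suc q" if "v \<in> pverts G" for v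
    using c that by (simp add: proper_coloring_def)
  have d_less: "d x < q" if "x \<in> pverts H" for x
    using d that by (simp add: proper_coloring_def)
  show ?thesis
    unfolding proper_coloring_def
  proof (intro conjI ballI impI)
    fix w assume "w \<in> pverts (corona G H)"
    then show "corona_coloring f c d w < Suc q"
      using less[OF c_less d_less] c_less by (auto simp: corona_coloring_def)
  next
    fix w z assume "w \<in> pverts (corona G H)" "z \<in> pverts (corona G H)"
      and "(w, z) \<in> parcs (corona G H)"
    moreover have "c u \<noteq> c v" if "u \<in> pverts G" "v \<in> pverts G" "(u, v) \<in> parcs G" for u v
      using c that by (simp add: proper_coloring_def)
    moreover have "d x \<noteq> d y" if "x \<in> pverts H" "y \<in> pverts H" "(x, y) \<in> parcs H" for x y
      using d that by (simp add: proper_coloring_def)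
    ultimately show "corona_coloring f c d w \<noteq> corona_coloring f c d z"
      by (cases w; cases z) (auto simp: corona_coloring_def neq neq[symmetric] inj c_less d_less)
  qed
qed

lemma card_color_class_corona_coloring:
  assumes "finite (pverts G)" and "finite (pverts H)"
    and f: "\<And>j. j < Suc q \<Longrightarrow> bij_betw (f j) {..<q} ({..<Suc q} - {j})"
    and c: "proper_coloring G (Suc q) c" and d: "proper_coloring H q d"
    and k: "\<And>i. i < q \<Longrightarrow> card (color_class H d i) = k" and "i < Suc q"
  shows "card (color_class (corona G H) (corona_coloring f c d) i)
    = card (color_class G c i) + k * (card (pverts G) - card (color_class G c i))"
proof -
  let ?fiber = "\<lambda>v. color_class H (\<lambda>x. f (c v) (d x)) i"
  have card_fiber: "card (?fiber v) = (if c v = i then 0 else k)" if "v \<in> pverts G" for v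
  proof -
    have "c v < Suc q" using c that by (simp add: proper_coloring_def)
    moreover have "\<forall>x\<in>pverts H. d x < q" using d by (simp add: proper_coloring_def)
    ultimately have "card (?fiber v) = (if i \<in> {..<Suc q} - {c v} then k else 0)"
      using f k by (intro card_color_class_recolor)
    with \<open>i < Suc q\<close> show ?thesis by simp
  qed
  have "color_class (corona G H) (corona_coloring f c d) i
      = color_class G c i <+> (SIGMA v:pverts G. ?fiber v)"
    by (auto simp: color_class_def corona_coloring_def)
  then have "card (color_class (corona G H) (corona_coloring f c d) i)
      = card (color_class G c i) + (\<Sum>v\<in>pverts G. card (?fiber v))"
    using assms(1,2) by (simp add: card_Plus color_class_def)
  also have "(\<Sum>v\<in>pverts G. card (?fiber v)) = (\<Sum>v\<in>pverts G. if c v = i then 0 else k)"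
    by (intro sum.cong refl card_fiber)
  also have "\<dots> = (\<Sum>v\<in>pverts G - color_class G c i. k)"
    using assms(1) by (intro sum.mono_neutral_cong_right) (auto simp: color_class_def)
  also have "\<dots> = k * (card (pverts G) - card (color_class G c i))"
    using assms(1) by (simp add: card_Diff_subset color_class_def mult.commute)
  finally show ?thesis .
qed

lemma equitable_coloring_corona_coloring:
  assumes "finite (pverts G)" and "finite (pverts H)"
    and f: "\<And>j. j < Suc q \<Longrightarrow> bij_betw (f j) {..<q} ({..<Suc q} - {j})"
    and c: "equitable_coloring G (Suc q) c" and d: "proper_coloring H q d"
    and k: "\<And>i. i < q \<Longrightarrow> card (color_class H d i) = k"
    and dvd_or_le: "Suc q dvd card (pverts G) \<or> k \<le> 2"
  shows "equitable_coloring (corona G H) (Suc q) (corona_coloring f c d)"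
  unfolding equitable_coloring_def
proof (intro conjI allI impI)
  have proper: "proper_coloring G (Suc q) c" using c by (simp add: equitable_coloring_def)
  then show "proper_coloring (corona G H) (Suc q) (corona_coloring f c d)"
    by (intro proper_coloring_corona_coloring f d)
  fix i j assume less: "i < Suc q" "j < Suc q"
  define a where "a i = card (color_class G c i)" for i
  have a_le: "a i \<le> card (pverts G)" for i
    using assms(1) by (auto simp: a_def color_class_def intro: card_mono)
  have card_eq: "int (card (color_class (corona G H) (corona_coloring f c d) i))
      = int (a i) + int k * (int (card (pverts G)) - int (a i))" if "i < Suc q" for i
    using card_color_class_corona_coloring[OF assms(1,2) f proper d k that] a_le
    by (simp add: a_def of_nat_diff)
  have "\<bar>int (a i) - int (a j)\<bar> \<le> 1"
    using c less by (simp add: equitable_coloring_def a_def)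
  moreover have "a i = a j \<or> \<bar>1 - int k\<bar> \<le> 1"
    using dvd_or_le card_color_class_eq_if_dvd[OF assms(1) c _ less] by (auto simp: a_def)
  ultimately have "\<bar>(1 - int k) * (int (a i) - int (a j))\<bar> \<le> 1"
    by (auto simp: abs_mult intro: mult_le_one)
  then show "\<bar>int (card (color_class (corona G H) (corona_coloring f c d) i))
      - int (card (color_class (corona G H) (corona_coloring f c d) j))\<bar> \<le> 1"
    by (simp add: card_eq less algebra_simps)
qed

lemma equitably_colorable_corona:
  assumes "finite (pverts G)" and "finite (pverts H)"
    and "equitably_colorable G (Suc q)" and "proper_coloring H q d"
    and "\<And>i. i < q \<Longrightarrow> card (color_class H d i) = k"
    and "Suc q dvd card (pverts G) \<or> k \<le> 2"
  shows "equitably_colorable (corona G H) (Suc q)"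
proof -
  have "\<exists>g. bij_betw g {..<q} ({..<Suc q} - {j})" if "j < Suc q" for j
    using that by (intro finite_same_card_bij) auto
  then obtain f where "\<And>j. j < Suc q \<Longrightarrow> bij_betw (f j) {..<q} ({..<Suc q} - {j})"
    by metis
  moreover obtain c where "equitable_coloring G (Suc q) c"
    using assms(3) unfolding equitably_colorable_iff_equitable_coloring ..
  ultimately have "equitable_coloring (corona G H) (Suc q) (corona_coloring f c d)"
    using assms(1,2,4-6) by (intro equitable_coloring_corona_coloring)
  then show ?thesis
    unfolding equitably_colorable_iff_equitable_coloring by blast
qed

lemma equitably_colorable_iterated_corona:
  assumes "finite (pverts G)" and "finite (pverts H)"
    and "equitably_colorable G (Suc q)" and "proper_coloring H q d"
    and "\<And>i. i < q \<Longrightarrow> card (color_class H d i) = k"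
    and "Suc q dvd card (pverts G) \<or> k \<le> 2"
  shows "equitably_colorable (iterated_corona l G H) (Suc q)"
proof (induction l)
  case 0
  show ?case using assms(3) by (simp add: equitably_colorable_rename_verts_iff inj_def)
next
  case (Suc l)
  have "Suc q dvd card (pverts (iterated_corona l G H)) \<or> k \<le> 2"
    using assms(1,2,6) by (auto simp: card_pverts_iterated_corona)
  then have "equitably_colorable (corona (iterated_corona l G H) H) (Suc q)"
    using finite_pverts_iterated_corona[OF assms(1,2)] assms(2) Suc assms(4,5)
    by (intro equitably_colorable_corona)
  then show ?case by (simp add: equitably_colorable_rename_verts_iff inj_def)
qed

section \<open>Cliques\<close>

definition clique :: "'a pair_pre_digraph \<Rightarrow> 'a set \<Rightarrow> bool" where
  "clique G S \<longleftrightarrow> S \<subseteq> pverts G \<and> (\<forall>u\<in>S. \<forall>v\<in>S. u \<noteq> v \<longrightarrow> (u, v) \<in> parcs G)"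

lemma clique_corona:
  assumes "clique H S" and "v \<in> pverts G"
  shows "clique (corona G H) ({v} <+> {v} \<times> S)"
  using assms by (fastforce simp: clique_def)

lemma card_clique_le_if_equitably_colorable:
  assumes "clique G S" and "equitably_colorable G q"
  shows "card S \<le> q"
proof -
  obtain c where c: "proper_coloring G q c"
    using assms(2) unfolding equitably_colorable_iff_equitable_coloring equitable_coloring_def
    by blast
  have "inj_on c S"
    using assms(1) c unfolding clique_def proper_coloring_def inj_on_def by blast
  moreover have "c ` S \<subseteq> {..<q}"
    using assms(1) c by (auto simp: clique_def proper_coloring_def)
  ultimately show ?thesis
    using card_inj_on_le[of c S "{..<q}"] by simp
qed

lemma card_clique_less_if_equitably_colorable_corona:
  assumes "pverts G \<noteq> {}" and "clique H S" and "finite S"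
    and "equitably_colorable (corona G H) q"
  shows "card S < q"
proof -
  obtain v where "v \<in> pverts G" using assms(1) by blast
  then have "clique (corona G H) ({v} <+> {v} \<times> S)"
    using assms(2) by (intro clique_corona)
  then have "card ({v} <+> {v} \<times> S) \<le> q"
    using assms(4) by (rule card_clique_le_if_equitably_colorable)
  then show ?thesis using assms(3) by (simp add: card_Plus card_cartesian_product)
qed

section \<open>Cycles\<close>

lemma proper_coloring_cycle_graph_mod:
  assumes "q \<ge> 2"
  shows "proper_coloring (cycle_graph (q * k)) q (\<lambda>x. x mod q)"
proof -
  have neq: "Suc x mod (q * k) mod q \<noteq> x mod q" for x
  proof -
    have "Suc x mod (q * k) mod q = Suc x mod q" by (simp add: mod_mod_cancel)
    then show ?thesis using assms by (simp add: mod_Suc)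
  qed
  then show ?thesis
    using assms by (auto simp: proper_coloring_def cycle_graph_def neq[symmetric])
qed

lemma card_color_class_cycle_graph_mod:
  assumes "i < q"
  shows "card (color_class (cycle_graph (q * k)) (\<lambda>x. x mod q) i) = k"
proof -
  have "color_class (cycle_graph (q * k)) (\<lambda>x. x mod q) i = (\<lambda>j. q * j + i) ` {..<k}"
  proof (intro equalityI subsetI)
    fix x assume "x \<in> color_class (cycle_graph (q * k)) (\<lambda>x. x mod q) i"
    then have "x = q * (x div q) + i" "x div q < k"
      by (auto simp: color_class_def cycle_graph_def less_mult_imp_div_less mult.commute)
    then show "x \<in> (\<lambda>j. q * j + i) ` {..<k}" by blast
  next
    fix x assume "x \<in> (\<lambda>j. q * j + i) ` {..<k}"
    then obtain j where j: "j < k" "x = q * j + i" by blast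
    have "q * j + i < q * Suc j" using assms by simp
    also have "\<dots> \<le> q * k" using j(1) by (intro mult_le_mono2) simp
    finally show "x \<in> color_class (cycle_graph (q * k)) (\<lambda>x. x mod q) i"
      using j assms by (simp add: color_class_def cycle_graph_def)
  qed
  then show ?thesis using assms by (simp add: card_image inj_on_def)
qed

section \<open>Equitable chromatic numbers\<close>

lemma equitable_chromatic_number_iterated_corona:
  assumes "finite (pverts G)" and "pverts G \<noteq> {}" and "finite (pverts H)"
    and "equitably_colorable G (Suc q)" and "proper_coloring H q d"
    and "\<And>i. i < q \<Longrightarrow> card (color_class H d i) = k"
    and "clique H S" and "card S = q"
    and "Suc q dvd card (pverts G) \<or> k \<le> 2" and "l \<ge> 1"
  shows "equitable_chromatic_number (iterated_corona l G H) = Suc q"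
  unfolding equitable_chromatic_number_def
proof (rule Least_equality)
  show "equitably_colorable (iterated_corona l G H) (Suc q)"
    using assms(1,3-6,9) by (rule equitably_colorable_iterated_corona)
next
  fix m assume m: "equitably_colorable (iterated_corona l G H) m"
  obtain l' where l: "l = Suc l'" using assms(10) by (cases l) auto
  have "card (pverts (iterated_corona l' G H)) \<noteq> 0"
    using assms(1-3) by (simp add: card_pverts_iterated_corona)
  then have "pverts (iterated_corona l' G H) \<noteq> {}" by auto
  moreover have "finite S"
    using assms(3,7) by (auto simp: clique_def intro: finite_subset)
  moreover have "equitably_colorable (corona (iterated_corona l' G H) H) m"
    using m by (simp add: l equitably_colorable_rename_verts_iff inj_def)
  ultimately have "card S < m"
    using assms(7) by (intro card_clique_less_if_equitably_colorable_corona)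
  then show "Suc q \<le> m" using assms(8) by simp
qed

theorem theorem2:
  fixes G :: "'a pair_pre_digraph" and n k l :: nat
  assumes "pair_graph G" and "connected (with_proj G)"
    and "card (pverts G) = n" and "n \<ge> 2"
    and "equitably_colorable G 3"
    and "k \<ge> 2" and "l \<ge> 1"
    and "3 dvd n \<or> k = 2"
  shows "equitable_chromatic_number (iterated_corona l G (cycle_graph (2 * k))) = 3"
proof -
  let ?C = "cycle_graph (2 * k)"
  interpret pair_graph G by fact
  have "equitable_chromatic_number (iterated_corona l G ?C) = Suc 2"
  proof (rule equitable_chromatic_number_iterated_corona)
    show "proper_coloring ?C 2 (\<lambda>x. x mod 2)"
      by (simp add: proper_coloring_cycle_graph_mod)
    show "card (color_class ?C (\<lambda>x. x mod 2) i) = k" if "i < 2" for i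
      using that by (rule card_color_class_cycle_graph_mod)
    show "clique ?C {0, 1}"
      using assms(6) by (auto simp: clique_def cycle_graph_def)
  qed (use assms in \<open>auto simp: cycle_graph_def\<close>)
  then show ?thesis by simp
qed

end
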